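(* Let $O$ be a unique sink orientation of $Q_n$, let $i\in[n]$, and let $P$ be an $i$-phase of $O$. Then the subgraph of the neighborhood graph $N_i$ induced by the edges in $P$ is connected.
   Context: The $n$-cube $Q_n$ is the graph on $\{0,1\}^n$ where two vertices are adjacent iff they differ in exactly one coordinate; an edge whose endpoints differ in coordinate $i$ is an $i$-edge, and $E_i$ is the set of $i$-edges. A face of $Q_n$ is given by a string $f\in\{0,1,*\}^n$ and is the induced subgraph on all $v$ with $v_i=f_i$ or $f_i=*$ for every $i$; its dimension is the number of $*$'s. An orientation is a function $O:\{0,1\}^n\to\{0,1\}^n$ (outmap) such that $O(v)_i\ne O(v')_i$ whenever $v,v'$ differ exactly in coordinate $i$; $O(v)_i=1$ means the $i$-edge at $v$ is outgoing from $v$, and $O(v)_i=0$ means it is incoming. $O$ is a unique sink orientation (USO) if every face contains exactly one vertex with no outgoing edges inside the face. Phases: let $O$ be a USO. Two $i$-edges $e,e'\in E_i$ are in direct phase if there exist $v\in e$, $w\in e'$ such that $O(v)_j=O(w)_j$ for all $j\neq i$ with $v_j\ne w_j$. Two $i$-edges are in phase if they are linked by a finite sequence of $i$-edges in which consecutive edges are in direct phase. An $i$-phase is an equivalence class of $E_i$ under this relation. The neighborhood graph $N_i$ has vertex set $E_i$; two distinct $i$-edges are adjacent in $N_i$ iff they are neighboring, i.e. some 2-dimensional face of $Q_n$ contains both of them. *)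

theory Defs
  imports "HOL-Analysis.Finite_Cartesian_Product" "Graph_Theory.Digraph_Component"
begin

text \<open>
  The vertices of the cube are the elements of \<^typ>\<open>bool ^ 'n\<close>, where the coordinates \<open>[n]\<close>
  are the elements of the finite type \<^typ>\<open>'n\<close> (so \<open>n = CARD('n)\<close>), and \<^const>\<open>True\<close> stands for 1.
\<close>

definition differ_exactly_in :: "'n \<Rightarrow> bool ^ 'n \<Rightarrow> bool ^ 'n \<Rightarrow> bool" where
  "differ_exactly_in i v w \<longleftrightarrow> (\<forall>j. v $ j \<noteq> w $ j \<longleftrightarrow> j = i)"

definition i_edges :: "'n \<Rightarrow> (bool ^ 'n) set set" where
  "i_edges i = {{v, w} | v w. differ_exactly_in i v w}"

text \<open>
  Faces are strings over \<open>{0,1,*}\<close>, with \<^const>\<open>None\<close> in the role of \<open>*\<close>. As a face is an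
  induced subgraph of the cube, an edge lies in it iff both endpoints lie in \<open>face_verts\<close>.
\<close>

definition face_verts :: "bool option ^ 'n \<Rightarrow> (bool ^ 'n) set" where
  "face_verts f = {v. \<forall>j. f $ j = Some (v $ j) \<or> f $ j = None}"

definition face_dim :: "bool option ^ 'n \<Rightarrow> nat" where
  "face_dim f = card {j. f $ j = None}"

definition orientation :: "(bool ^ 'n \<Rightarrow> bool ^ 'n) \<Rightarrow> bool" where
  "orientation out \<longleftrightarrow> (\<forall>i v w. differ_exactly_in i v w \<longrightarrow> out v $ i \<noteq> out w $ i)"

definition face_sink :: "(bool ^ 'n \<Rightarrow> bool ^ 'n) \<Rightarrow> bool option ^ 'n \<Rightarrow> bool ^ 'n \<Rightarrow> bool" where
  "face_sink out f v \<longleftrightarrow> v \<in> face_verts f \<and>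
     \<not> (\<exists>j. \<exists>w \<in> face_verts f. differ_exactly_in j v w \<and> out v $ j)"

definition unique_sink_orientation :: "(bool ^ 'n \<Rightarrow> bool ^ 'n) \<Rightarrow> bool" where
  "unique_sink_orientation out \<longleftrightarrow> orientation out \<and> (\<forall>f. \<exists>!v. face_sink out f v)"

definition direct_phase ::
  "(bool ^ 'n \<Rightarrow> bool ^ 'n) \<Rightarrow> 'n \<Rightarrow> ((bool ^ 'n) set \<times> (bool ^ 'n) set) set" where
  "direct_phase out i = {(e, e'). e \<in> i_edges i \<and> e' \<in> i_edges i \<and>
     (\<exists>v\<in>e. \<exists>w\<in>e'. \<forall>j. j \<noteq> i \<and> v $ j \<noteq> w $ j \<longrightarrow> out v $ j = out w $ j)}"

definition in_phase ::
  "(bool ^ 'n \<Rightarrow> bool ^ 'n) \<Rightarrow> 'n \<Rightarrow> ((bool ^ 'n) set \<times> (bool ^ 'n) set) set" where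
  "in_phase out i = {(e, e') \<in> i_edges i \<times> i_edges i. (e, e') \<in> (direct_phase out i)\<^sup>*}"

definition phases :: "(bool ^ 'n \<Rightarrow> bool ^ 'n) \<Rightarrow> 'n \<Rightarrow> (bool ^ 'n) set set set" where
  "phases out i = i_edges i // in_phase out i"

lemma equiv_in_phase: "equiv (i_edges i) (in_phase out i)"
proof (rule equivI)
  have "sym (direct_phase out i)"
  proof (rule symI)
    fix e e' assume "(e, e') \<in> direct_phase out i"
    then obtain v w where e: "e \<in> i_edges i" "e' \<in> i_edges i" "v \<in> e" "w \<in> e'"
      and "\<forall>j. j \<noteq> i \<and> v $ j \<noteq> w $ j \<longrightarrow> out v $ j = out w $ j"
      unfolding direct_phase_def by blast
    then have "\<forall>j. j \<noteq> i \<and> w $ j \<noteq> v $ j \<longrightarrow> out w $ j = out v $ j"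
      by metis
    with e show "(e', e) \<in> direct_phase out i"
      unfolding direct_phase_def by blast
  qed
  then have "sym ((direct_phase out i)\<^sup>*)"
    by (rule sym_rtrancl)
  then show "sym (in_phase out i)"
    unfolding in_phase_def sym_def by blast
  show "refl_on (i_edges i) (in_phase out i)"
    unfolding refl_on_def in_phase_def by blast
  show "trans (in_phase out i)"
    unfolding in_phase_def trans_def by (blast intro: rtrancl_trans)
qed (auto simp: in_phase_def)

definition neighboring :: "(bool ^ 'n) set \<Rightarrow> (bool ^ 'n) set \<Rightarrow> bool" where
  "neighboring e e' \<longleftrightarrow> (\<exists>f. face_dim f = 2 \<and> e \<subseteq> face_verts f \<and> e' \<subseteq> face_verts f)"

text \<open>Undirected graphs are represented by their symmetric digraphs.\<close>

definition neighborhood_graph :: "'n \<Rightarrow> (bool ^ 'n) set pair_pre_digraph" where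
  "neighborhood_graph i = \<lparr> pverts = i_edges i,
     parcs = {(e, e'). e \<in> i_edges i \<and> e' \<in> i_edges i \<and> e \<noteq> e' \<and> neighboring e e'} \<rparr>"

lemma pair_graph_neighborhood_graph: "pair_graph (neighborhood_graph i)"
proof
  show "finite (pverts (neighborhood_graph i))" "finite (parcs (neighborhood_graph i))"
    by simp_all
  show "symmetric (with_proj (neighborhood_graph i))"
    by (auto simp: symmetric_def sym_def arcs_ends_def arc_to_ends_def
      neighborhood_graph_def neighboring_def)
qed (auto simp: neighborhood_graph_def)

end

theory Submission
  imports Defs
begin

text \<open>
  Suppose a phase splits into two parts \<open>A\<close> and \<open>B\<close> with no neighboring pair between them, and
  reverse the edges in \<open>A\<close>. As \<open>A\<close> is not a union of phases, some pair of distinct vertices then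
  violates the Szabo-Welzl condition, by which any two distinct vertices \<open>v\<close>, \<open>w\<close> of a unique
  sink orientation have outmaps differing in a coordinate in which \<open>v\<close> and \<open>w\<close> differ. On a face
  spanned by a violating pair and of minimal dimension, every antipodal pair of vertices is
  violating. Since the original orientation has no such pair, exactly one of the two \<open>i\<close>-edges at
  antipodal vertices lies in \<open>A\<close>, and these two are in direct phase, so the other lies in \<open>B\<close>.
  Hence the \<open>i\<close>-edges of the face, which are connected in the neighborhood graph, all lie in
  \<open>A\<close> or \<open>B\<close> and meet both: a contradiction.
\<close>

section \<open>Coordinate flips on the vertices of the cube\<close>

definition diff_coords :: "bool ^ 'n \<Rightarrow> bool ^ 'n \<Rightarrow> 'n set" where
  "diff_coords v w = {j. v $ j \<noteq> w $ j}"

definition flip_coords :: "'n set \<Rightarrow> bool ^ 'n \<Rightarrow> bool ^ 'n" where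
  "flip_coords S v = (\<chi> j. v $ j \<noteq> (j \<in> S))"

text \<open>The Szabo-Welzl condition for a single pair. It fails for equal vertices, so violations
  are sought among distinct ones.\<close>

definition separated :: "(bool ^ 'n \<Rightarrow> bool ^ 'n) \<Rightarrow> bool ^ 'n \<Rightarrow> bool ^ 'n \<Rightarrow> bool" where
  "separated out v w \<longleftrightarrow> (\<exists>j\<in>diff_coords v w. out v $ j \<noteq> out w $ j)"

lemma flip_coords_nth [simp]: "flip_coords S v $ j \<longleftrightarrow> v $ j \<noteq> (j \<in> S)"
  by (simp add: flip_coords_def)

lemma in_diff_coords [simp]: "j \<in> diff_coords v w \<longleftrightarrow> v $ j \<noteq> w $ j"
  by (simp add: diff_coords_def)

lemma diff_coords_empty_iff: "diff_coords v w = {} \<longleftrightarrow> v = w"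
  by (auto simp: diff_coords_def vec_eq_iff)

lemma flip_coords_diff_coords: "flip_coords (diff_coords v w) v = w"
  by (auto simp: vec_eq_iff)

lemma flip_coords_flip_coords [simp]: "flip_coords S (flip_coords S v) = v"
  by (auto simp: vec_eq_iff)

lemma diff_coords_flip_coords [simp]: "diff_coords v (flip_coords S v) = S"
  by auto

lemma flip_coords_insert:
  "k \<notin> S \<Longrightarrow> flip_coords (insert k S) v = flip_coords {k} (flip_coords S v)"
  by (auto simp: vec_eq_iff)

lemma differ_exactly_in_iff: "differ_exactly_in i v w \<longleftrightarrow> w = flip_coords {i} v"
  by (auto simp: differ_exactly_in_def vec_eq_iff)

subsection \<open>The Szabo-Welzl condition\<close>

text \<open>Flipping \<open>j\<close> stays in the face with base vertex \<open>b\<close> and free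
  coordinates \<open>D\<close> exactly when \<open>j \<in> D\<close>, so its sink is the vertex
  whose outmap vanishes on \<open>D\<close>.\<close>

lemma ex1_face_sink:
  fixes out :: "bool ^ 'n \<Rightarrow> bool ^ 'n"
  assumes "unique_sink_orientation out"
  shows "\<exists>!x. diff_coords b x \<subseteq> D \<and> (\<forall>j\<in>D. \<not> out x $ j)"
proof -
  define f :: "bool option ^ 'n" where "f = (\<chi> j. if j \<in> D then None else Some (b $ j))"
  have verts: "x \<in> face_verts f \<longleftrightarrow> diff_coords b x \<subseteq> D" for x
    by (auto simp: face_verts_def f_def)
  have "face_sink out f = (\<lambda>x. diff_coords b x \<subseteq> D \<and> (\<forall>j\<in>D. \<not> out x $ j))"
  proof
    fix x
    have "flip_coords {j} x \<in> face_verts f \<longleftrightarrow> j \<in> D" if "diff_coords b x \<subseteq> D" for j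
      using that by (auto simp: verts subset_iff)
    then show "face_sink out f x = (diff_coords b x \<subseteq> D \<and> (\<forall>j\<in>D. \<not> out x $ j))"
      unfolding face_sink_def differ_exactly_in_iff by (auto simp: verts[of x])
  qed
  moreover have "Ex1 (face_sink out f)"
    using assms unfolding unique_sink_orientation_def by blast
  ultimately show ?thesis by simp
qed

text \<open>
  Complementing a coordinate \<open>k\<close> of the prescribed pattern swaps which of the two solutions in
  the two \<open>k\<close>-facets solves the whole face.
\<close>

lemma ex1_outmap_pattern:
  fixes out :: "bool ^ 'n \<Rightarrow> bool ^ 'n"
  assumes "unique_sink_orientation out"
  shows "\<exists>!x. diff_coords b x \<subseteq> D \<and> (\<forall>j\<in>D. out x $ j \<longleftrightarrow> j \<in> S)"
  using finite[of S]
proof (induction S arbitrary: b D rule: finite_induct)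
  case empty
  then show ?case using ex1_face_sink[OF assms] by simp
next
  case (insert k S)
  let ?Q = "\<lambda>S b D x. diff_coords b x \<subseteq> D \<and> (\<forall>j\<in>D. out x $ j \<longleftrightarrow> j \<in> S)"
  show ?case
  proof (cases "k \<in> D")
    case False
    then have "?Q (insert k S) b D x \<longleftrightarrow> ?Q S b D x" for x by auto
    then show ?thesis using insert.IH by simp
  next
    case True
    let ?b' = "flip_coords {k} b"
    obtain x0 where x0: "?Q S b (D - {k}) x0"
      and u0: "\<And>y. ?Q S b (D - {k}) y \<Longrightarrow> y = x0"
      using insert.IH[of b "D - {k}"] by blast
    obtain x1 where x1: "?Q S ?b' (D - {k}) x1"
      and u1: "\<And>y. ?Q S ?b' (D - {k}) y \<Longrightarrow> y = x1"
      using insert.IH[of ?b' "D - {k}"] by blast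
    obtain x where x: "?Q S b D x" and u: "\<And>y. ?Q S b D y \<Longrightarrow> y = x"
      using insert.IH[of b D] by blast
    have k: "x0 $ k = b $ k" "x1 $ k \<noteq> b $ k" using x0 x1 by auto
    then have ne: "x0 \<noteq> x1" by auto
    have face: "diff_coords b x0 \<subseteq> D" "diff_coords b x1 \<subseteq> D"
      using x0 x1 True by (auto simp: subset_iff split: if_splits)
    have cases: "y = x0 \<or> y = x1"
      if "diff_coords b y \<subseteq> D" "\<forall>j\<in>D - {k}. out y $ j \<longleftrightarrow> j \<in> S" for y
    proof (cases "y $ k = b $ k")
      case True
      then show ?thesis using that by (intro disjI1 u0) auto
    next
      case False
      then show ?thesis using that by (intro disjI2 u1) auto
    qed
    have old: "?Q S b D y \<longleftrightarrow> (y = x0 \<or> y = x1) \<and> \<not> out y $ k" for y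
      using cases[of y] face x0 x1 \<open>k \<notin> S\<close> True by auto
    have new: "?Q (insert k S) b D y \<longleftrightarrow> (y = x0 \<or> y = x1) \<and> out y $ k" for y
      using cases[of y] face x0 x1 \<open>k \<notin> S\<close> True by auto
    \<comment> \<open>As \<open>k \<notin> S\<close>, the pattern \<open>S\<close> asks for entry 0
      at \<open>k\<close>, and exactly one of \<open>x0\<close>, \<open>x1\<close> has it; the other
      solves \<open>insert k S\<close>.\<close>
    have "out x0 $ k \<noteq> out x1 $ k"
      using x u ne unfolding old by metis
    then show ?thesis unfolding new by metis
  qed
qed

text \<open>Otherwise both vertices would attain the outmap pattern of \<open>v\<close> on the face
  they span.\<close>

lemma unique_sink_orientation_separated:
  assumes "unique_sink_orientation out" "v \<noteq> w"
  shows "separated out v w"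
proof (rule ccontr)
  assume "\<not> separated out v w"
  then have "\<forall>j\<in>diff_coords v w. out w $ j \<longleftrightarrow> j \<in> {j. out v $ j}"
    by (auto simp: separated_def)
  moreover have "diff_coords v v \<subseteq> diff_coords v w" by auto
  ultimately show False
    using ex1_outmap_pattern[OF assms(1), of v "diff_coords v w" "{j. out v $ j}"] assms(2)
    by blast
qed

subsection \<open>Minimal faces violating the Szabo-Welzl condition\<close>

text \<open>A face has as many vertices as outmap patterns, and separation makes the map between
  them injective, hence onto. This serves the facets of a minimal violating face, where only
  separation is known.\<close>

lemma ex_outmap_pattern:
  fixes out :: "bool ^ 'n \<Rightarrow> bool ^ 'n"
  assumes "\<And>x y. x \<noteq> y \<Longrightarrow> diff_coords x y \<subseteq> D \<Longrightarrow> separated out x y"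
  obtains x where "diff_coords b x \<subseteq> D" "\<forall>j\<in>D. out x $ j = p $ j"
proof -
  let ?g = "\<lambda>T. {j\<in>D. out (flip_coords T b) $ j}"
  have "inj_on ?g (Pow D)"
  proof (rule inj_onI, rule ccontr)
    fix T T' assume T: "T \<in> Pow D" "T' \<in> Pow D" "?g T = ?g T'" "T \<noteq> T'"
    let ?x = "flip_coords T b" and ?y = "flip_coords T' b"
    have "?x \<noteq> ?y" using T(4) by (metis diff_coords_flip_coords)
    moreover have *: "diff_coords ?x ?y \<subseteq> D" using T by auto
    ultimately have "separated out ?x ?y" by (rule assms)
    then show False using T(3) * unfolding separated_def by blast
  qed
  then have "?g ` Pow D = Pow D" by (intro endo_inj_surj) auto
  moreover have "{j\<in>D. p $ j} \<in> Pow D" by auto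
  ultimately obtain T where "T \<subseteq> D" "{j\<in>D. p $ j} = ?g T" by (metis (no_types, lifting) PowD imageE)
  then show ?thesis by (intro that[of "flip_coords T b"]) auto
qed

text \<open>
  Every pattern is attained exactly once (up to its \<open>k\<close>-th entry) on each of the two \<open>k\<close>-facets.
  Hence a pattern attained twice on the face has no solution after complementing any one of its
  entries, and vice versa; so each pattern is attained twice or not at all.
\<close>

lemma not_separated_antipodal:
  fixes out :: "bool ^ 'n \<Rightarrow> bool ^ 'n"
  assumes vw: "v \<noteq> w" "\<not> separated out v w"
    and min: "\<And>x y. x \<noteq> y \<Longrightarrow> diff_coords x y \<subset> diff_coords v w \<Longrightarrow> separated out x y"
    and x: "diff_coords v x \<subseteq> diff_coords v w"
  shows "\<not> separated out x (flip_coords (diff_coords v w) x)"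
proof -
  define D where "D = diff_coords v w"
  define N where "N p = {x. diff_coords v x \<subseteq> D \<and> (\<forall>j\<in>D. out x $ j = p $ j)}" for p
  have twice_or_never: "(\<exists>y\<in>N (flip_coords T (out v)). \<exists>z\<in>N (flip_coords T (out v)). y \<noteq> z)
      \<or> N (flip_coords T (out v)) = {}" if "T \<subseteq> D" for T
    using finite[of T] that
  proof (induction T rule: finite_induct)
    case empty
    have "v \<in> N (flip_coords {} (out v))" "w \<in> N (flip_coords {} (out v))"
      using vw(2) by (auto simp: N_def D_def separated_def)
    then show ?case using vw(1) by blast
  next
    case (insert k T)
    define p where "p = flip_coords T (out v)"
    have k: "k \<in> D" using insert by auto
    \<comment> \<open>A \<open>k\<close>-facet is a proper subface, so minimality separates its
      vertices.\<close>
    have sep: "separated out x y" if "x \<noteq> y" "diff_coords x y \<subseteq> D - {k}" for x y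
      using that k by (intro min) (auto simp: D_def)
    obtain x0 where x0: "diff_coords v x0 \<subseteq> D - {k}" "\<forall>j\<in>D - {k}. out x0 $ j = p $ j"
      using ex_outmap_pattern[OF sep] by blast
    obtain x1 where x1: "diff_coords (flip_coords {k} v) x1 \<subseteq> D - {k}"
        "\<forall>j\<in>D - {k}. out x1 $ j = p $ j"
      using ex_outmap_pattern[OF sep] by blast
    have xk: "x0 $ k = v $ k" "x1 $ k \<noteq> v $ k"
      using x0(1) x1(1) by (simp_all add: subset_iff) blast+
    then have ne: "x0 \<noteq> x1" by auto
    have "diff_coords v x1 \<subseteq> insert k (diff_coords (flip_coords {k} v) x1)" by auto
    then have face: "diff_coords v x0 \<subseteq> D" "diff_coords v x1 \<subseteq> D"
      using x0(1) x1(1) k by blast+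
    have facet: "y = z" if "diff_coords y z \<subseteq> D - {k}"
      "\<forall>j\<in>D - {k}. out y $ j = p $ j" "\<forall>j\<in>D - {k}. out z $ j = p $ j" for y z
      using sep[of y z] that unfolding separated_def by (metis subsetD)
    have cases: "y = x0 \<or> y = x1"
      if y: "diff_coords v y \<subseteq> D" "\<forall>j\<in>D - {k}. out y $ j = p $ j" for y
    proof (cases "y $ k = v $ k")
      case True
      then have "diff_coords y x0 \<subseteq> D - {k}"
        using x0(1) y(1) unfolding subset_iff in_diff_coords by blast
      then show ?thesis using facet y(2) x0(2) by blast
    next
      case False
      then have "diff_coords y x1 \<subseteq> D - {k}"
        using face(2) xk(2) y(1) unfolding subset_iff in_diff_coords by blast
      then show ?thesis using facet y(2) x1(2) by blast
    qed
    have old: "y \<in> N p \<longleftrightarrow> (y = x0 \<or> y = x1) \<and> out y $ k = p $ k" for y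
    proof -
      have "(\<forall>j\<in>D. out y $ j = p $ j) \<longleftrightarrow> (\<forall>j\<in>D - {k}. out y $ j = p $ j) \<and> out y $ k = p $ k"
        using k by blast
      then show ?thesis using cases[of y] face x0(2) x1(2) unfolding N_def by blast
    qed
    have new: "y \<in> N (flip_coords {k} p) \<longleftrightarrow> (y = x0 \<or> y = x1) \<and> out y $ k \<noteq> p $ k" for y
    proof -
      have "(\<forall>j\<in>D. out y $ j = flip_coords {k} p $ j) \<longleftrightarrow>
          (\<forall>j\<in>D - {k}. out y $ j = p $ j) \<and> out y $ k \<noteq> p $ k"
        unfolding flip_coords_nth using k by blast
      then show ?thesis using cases[of y] face x0(2) x1(2) unfolding N_def by blast
    qed
    have "(\<exists>y\<in>N p. \<exists>z\<in>N p. y \<noteq> z) \<or> N p = {}"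
      using insert by (simp add: p_def)
    \<comment> \<open>\<open>N p\<close> is contained in \<open>{x0, x1}\<close> and holds both or
      neither, so the two either both match or both miss entry \<open>k\<close> of
      \<open>p\<close>.\<close>
    then have both: "out x0 $ k = p $ k \<longleftrightarrow> out x1 $ k = p $ k"
      using old by (metis empty_iff)
    have "(\<exists>y\<in>N (flip_coords {k} p). \<exists>z\<in>N (flip_coords {k} p). y \<noteq> z)
        \<or> N (flip_coords {k} p) = {}"
    proof (cases "out x0 $ k = p $ k")
      case True
      then have "y \<notin> N (flip_coords {k} p)" for y using new both by metis
      then show ?thesis by blast
    next
      case False
      then have "x0 \<in> N (flip_coords {k} p)" "x1 \<in> N (flip_coords {k} p)"
        using new both by metis+
      then show ?thesis using ne by blast
    qed
    then show ?case
      unfolding flip_coords_insert[OF insert.hyps(2)] p_def .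
  qed
  \<comment> \<open>On \<open>D\<close> this is the outmap pattern of \<open>x\<close>, written as a
    modification of \<open>out v\<close> so that \<open>twice_or_never\<close> applies. By
    minimality, the second vertex attaining it is antipodal to \<open>x\<close>.\<close>
  define q where "q = flip_coords (diff_coords (out v) (out x) \<inter> D) (out v)"
  have "\<forall>j\<in>D. out x $ j = q $ j" by (auto simp: q_def)
  then have "x \<in> N q" using x by (simp add: N_def D_def)
  then obtain z where z: "z \<in> N q" "z \<noteq> x"
    using twice_or_never[of "diff_coords (out v) (out x) \<inter> D"] unfolding q_def by blast
  have agree: "diff_coords x z \<subseteq> D" "\<forall>j\<in>D. out x $ j = out z $ j"
    using z(1) \<open>x \<in> N q\<close> unfolding N_def subset_iff mem_Collect_eq in_diff_coords by blast+
  then have "\<not> separated out x z" unfolding separated_def by blast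
  moreover from this have "diff_coords x z = D"
    using min[of x z] z(2) agree(1) unfolding D_def by blast
  then have "z = flip_coords D x" using flip_coords_diff_coords by metis
  ultimately show ?thesis by (simp add: D_def)
qed

text \<open>Flipping the elements of \<open>T\<close> one at a time leads out of \<open>M\<close>,
  so some single flip leaves it.\<close>

lemma ex_flip_step:
  assumes "finite T" "v \<in> M" "flip_coords T v \<notin> M"
  obtains S k where "insert k S \<subseteq> T" "k \<notin> S" "flip_coords S v \<in> M" "flip_coords (insert k S) v \<notin> M"
  using assms
proof (induction T arbitrary: thesis rule: finite_induct)
  case empty
  have "flip_coords {} v = v" by (simp add: vec_eq_iff)
  then show ?case using empty by simp
next
  case (insert k T)
  show ?case
  proof (cases "flip_coords T v \<in> M")
    case True
    then show ?thesis using insert by blast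
  next
    case False
    show ?thesis
    proof (rule insert.IH)
      fix k' S assume "insert k' S \<subseteq> T" "k' \<notin> S" "flip_coords S v \<in> M" "flip_coords (insert k' S) v \<notin> M"
      then show thesis by (intro insert.prems(1)[of k' S]) auto
    qed (use insert False in auto)
  qed
qed

text \<open>
  Complement the \<open>i\<close>-th entry of the outmap on \<open>M\<close>. On a minimal face violating the Szabo-Welzl
  condition afterwards, exactly one vertex of each antipodal pair lies in \<open>M\<close>, and the two are in
  direct phase.
\<close>

lemma ex_adjacent_in_direct_phase:
  fixes out :: "bool ^ 'n \<Rightarrow> bool ^ 'n"
  assumes sw: "\<And>x y. x \<noteq> y \<Longrightarrow> separated out x y"
    and M: "\<And>x. flip_coords {i} x \<in> M \<longleftrightarrow> x \<in> M"
    and vw: "v \<in> M" "w \<notin> M" "\<forall>j. j \<noteq> i \<and> v $ j \<noteq> w $ j \<longrightarrow> out v $ j = out w $ j"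
  obtains x k z where "x \<in> M" "k \<noteq> i" "flip_coords {k} x \<notin> M" "z \<in> M"
    "\<forall>j. j \<noteq> i \<and> z $ j \<noteq> flip_coords {k} x $ j \<longrightarrow> out z $ j = out (flip_coords {k} x) $ j"
proof -
  define out' where "out' x = (if x \<in> M then flip_coords {i} (out x) else out x)" for x
  \<comment> \<open>Only entry \<open>i\<close> changes. Since \<open>out\<close> separates
    \<open>x\<close> and \<open>y\<close>, a violation needs \<open>i\<close> to be the sole
    coordinate doing so and the change to occur at exactly one of them.\<close>
  have bad_iff: "\<not> separated out' x y \<longleftrightarrow> (x \<in> M) \<noteq> (y \<in> M) \<and> x $ i \<noteq> y $ i \<and>
      (\<forall>j. j \<noteq> i \<and> x $ j \<noteq> y $ j \<longrightarrow> out x $ j = out y $ j)" if "x \<noteq> y" for x y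
  proof -
    let ?agree = "\<forall>j. j \<noteq> i \<and> x $ j \<noteq> y $ j \<longrightarrow> out x $ j = out y $ j"
    have nth: "out' z $ j \<longleftrightarrow> out z $ j \<noteq> (j = i \<and> z \<in> M)" for z j
      by (simp add: out'_def)
    have split: "(\<exists>j. R j) \<longleftrightarrow> R i \<or> (\<exists>j. j \<noteq> i \<and> R j)" for R :: "'n \<Rightarrow> bool"
      by metis
    have "separated out' x y \<longleftrightarrow> (\<exists>j. x $ j \<noteq> y $ j \<and> out' x $ j \<noteq> out' y $ j)"
      by (simp add: separated_def Bex_def)
    also have "\<dots> \<longleftrightarrow>
        x $ i \<noteq> y $ i \<and> (out x $ i \<noteq> (x \<in> M)) \<noteq> (out y $ i \<noteq> (y \<in> M)) \<or> \<not> ?agree"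
      by (subst split) (simp add: nth cong: conj_cong)
    finally have "separated out' x y \<longleftrightarrow>
        x $ i \<noteq> y $ i \<and> (out x $ i \<noteq> (x \<in> M)) \<noteq> (out y $ i \<noteq> (y \<in> M)) \<or> \<not> ?agree" .
    moreover have "x $ i \<noteq> y $ i \<and> out x $ i \<noteq> out y $ i" if ?agree
      using sw[OF \<open>x \<noteq> y\<close>] that unfolding separated_def by (metis in_diff_coords)
    ultimately show ?thesis by blast
  qed
  have "v \<noteq> w" using vw by auto
  then have "v $ i \<noteq> w $ i" using sw[of v w] vw(3) by (auto simp: separated_def)
  then have "\<not> separated out' v w" using bad_iff[OF \<open>v \<noteq> w\<close>] vw by blast
  define bad where "bad = (\<lambda>(x, y). x \<noteq> y \<and> \<not> separated out' x y)"
  have "bad (v, w)" using \<open>v \<noteq> w\<close> \<open>\<not> separated out' v w\<close> by (simp add: bad_def)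
  then obtain ab where ab: "bad ab"
    "\<And>xy. bad xy \<Longrightarrow> card (case_prod diff_coords ab) \<le> card (case_prod diff_coords xy)"
    using ex_has_least_nat[of bad "(v, w)" "\<lambda>xy. card (case_prod diff_coords xy)"]
    by blast
  obtain a b where "ab = (a, b)" by (cases ab)
  have ab_ne: "a \<noteq> b" and ab_bad: "\<not> separated out' a b"
    using ab(1) \<open>ab = (a, b)\<close> by (auto simp: bad_def)
  have min: "separated out' x y" if "x \<noteq> y" "diff_coords x y \<subset> diff_coords a b" for x y
    using ab(2)[of "(x, y)"] that psubset_card_mono[OF _ that(2)] \<open>ab = (a, b)\<close>
    by (auto simp: bad_def)
  define D where "D = diff_coords a b"
  have D: "i \<in> D" using bad_iff[OF ab_ne] ab_bad by (simp add: D_def)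
  have antipodal: "(x \<in> M) \<noteq> (flip_coords D x \<in> M)"
    "\<forall>j. j \<noteq> i \<and> j \<in> D \<longrightarrow> out x $ j = out (flip_coords D x) $ j" if "diff_coords a x \<subseteq> D" for x
  proof -
    have "x \<noteq> flip_coords D x" using D by (metis diff_coords_flip_coords diff_coords_empty_iff empty_iff)
    moreover have "\<not> separated out' x (flip_coords D x)"
      using not_separated_antipodal[OF ab_ne ab_bad min] that by (simp add: D_def)
    ultimately have "(x \<in> M) \<noteq> (flip_coords D x \<in> M) \<and>
      (\<forall>j. j \<noteq> i \<and> x $ j \<noteq> flip_coords D x $ j \<longrightarrow> out x $ j = out (flip_coords D x) $ j)"
      using bad_iff by blast
    then show "(x \<in> M) \<noteq> (flip_coords D x \<in> M)"
      "\<forall>j. j \<noteq> i \<and> j \<in> D \<longrightarrow> out x $ j = out (flip_coords D x) $ j" by auto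
  qed
  \<comment> \<open>Whichever of two antipodal vertices lies in \<open>M\<close>, as the start of a
    walk out of \<open>M\<close>.\<close>
  define c where "c = (if a \<in> M then a else flip_coords D a)"
  have c_face: "diff_coords a (flip_coords S c) \<subseteq> D" if "S \<subseteq> D" for S
    using that by (auto simp: c_def)
  \<comment> \<open>As \<open>M\<close> is closed under flipping \<open>i\<close>, the walk leaves
    \<open>M\<close> without that flip, so \<open>k \<noteq> i\<close>.\<close>
  have flip_D: "flip_coords D c = flip_coords {i} (flip_coords (D - {i}) c)"
    using flip_coords_insert[of i "D - {i}" c] D by (simp add: insert_absorb)
  have "c \<in> M" "flip_coords D c \<notin> M"
    using antipodal(1)[of a] by (auto simp: c_def diff_coords_empty_iff[THEN iffD2])
  then have "flip_coords (D - {i}) c \<notin> M" using M by (simp add: flip_D)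
  then obtain S k where S: "insert k S \<subseteq> D - {i}" "k \<notin> S" "flip_coords S c \<in> M"
    "flip_coords (insert k S) c \<notin> M"
    using ex_flip_step[OF finite \<open>c \<in> M\<close>] by blast
  \<comment> \<open>\<open>y\<close> lies just outside \<open>M\<close>, so its antipode in the face
    lies in \<open>M\<close>, and their \<open>i\<close>-edges are in direct phase.\<close>
  define y where "y = flip_coords (insert k S) c"
  have y: "y = flip_coords {k} (flip_coords S c)" unfolding y_def by (rule flip_coords_insert[OF S(2)])
  have "diff_coords a y \<subseteq> D" unfolding y_def using S(1) by (intro c_face) auto
  note anti = antipodal[OF this]
  show ?thesis
  proof (rule that[of "flip_coords S c" k "flip_coords D y"])
    show "flip_coords D y \<in> M" using anti(1) S(4) y_def by auto
    show "\<forall>j. j \<noteq> i \<and> flip_coords D y $ j \<noteq> flip_coords {k} (flip_coords S c) $ j \<longrightarrow>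
        out (flip_coords D y) $ j = out (flip_coords {k} (flip_coords S c)) $ j"
      using anti(2) unfolding y[symmetric] by auto
  qed (use S y y_def in auto)
qed

subsection \<open>Connectedness of phases\<close>

lemma i_edges_iff: "e \<in> i_edges i \<longleftrightarrow> (\<exists>v. e = {v, flip_coords {i} v})"
  by (auto simp: i_edges_def differ_exactly_in_iff)

lemma i_edge_eqI:
  assumes "e \<in> i_edges i" "v \<in> e"
  shows "e = {v, flip_coords {i} v}"
  using assms by (auto simp: i_edges_iff)

lemma neighboring_flip_coords:
  assumes "k \<noteq> i"
  shows "neighboring {x, flip_coords {i} x} {flip_coords {k} x, flip_coords {i} (flip_coords {k} x)}"
proof -
  define f where "f = (\<chi> j. if j \<in> {i, k} then None else Some (x $ j))"
  have "{j. f $ j = None} = {i, k}" by (auto simp: f_def)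
  then have "face_dim f = 2" using assms by (simp add: face_dim_def)
  then show ?thesis unfolding neighboring_def by (intro exI[of _ f]) (auto simp: face_verts_def f_def)
qed

text \<open>The edge \<open>b\<close> is tied to \<open>A\<close> twice: \<open>c\<close> puts it
  into the same phase, \<open>a\<close> makes it adjacent in the neighborhood graph. It is found by
  replacing \<open>A\<close> with the set of its endpoints.\<close>

lemma ex_neighboring_in_direct_phase:
  assumes uso: "unique_sink_orientation out" and A: "A \<subseteq> i_edges i"
    and step: "(e, e') \<in> direct_phase out i" "e \<in> A" "e' \<notin> A"
  obtains a b c where "a \<in> A" "b \<in> i_edges i - A" "neighboring a b" "c \<in> A" "(c, b) \<in> direct_phase out i"
proof -
  define edge where "edge x = {x, flip_coords {i} x}" for x :: "bool ^ 'a"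
  define M where "M = {x. edge x \<in> A}"
  have edge_in: "edge x \<in> i_edges i" for x by (auto simp: i_edges_iff edge_def)
  obtain v w where e: "e \<in> i_edges i" "e' \<in> i_edges i" "v \<in> e" "w \<in> e'"
    and vw: "\<forall>j. j \<noteq> i \<and> v $ j \<noteq> w $ j \<longrightarrow> out v $ j = out w $ j"
    using step(1) unfolding direct_phase_def by blast
  have "e = edge v" "e' = edge w" using e i_edge_eqI unfolding edge_def by blast+
  then have "v \<in> M" "w \<notin> M" using step by (auto simp: M_def)
  moreover have "flip_coords {i} x \<in> M \<longleftrightarrow> x \<in> M" for x
    by (simp add: M_def edge_def insert_commute)
  ultimately obtain x k z where x: "x \<in> M" "k \<noteq> i" "flip_coords {k} x \<notin> M" "z \<in> M"
    "\<forall>j. j \<noteq> i \<and> z $ j \<noteq> flip_coords {k} x $ j \<longrightarrow> out z $ j = out (flip_coords {k} x) $ j"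
    using ex_adjacent_in_direct_phase[OF unique_sink_orientation_separated[OF uso] _ _ _ vw] by metis
  have "(edge z, edge (flip_coords {k} x)) \<in> direct_phase out i"
    unfolding direct_phase_def using x(5) edge_in by (auto simp: edge_def)
  moreover have "neighboring (edge x) (edge (flip_coords {k} x))"
    unfolding edge_def by (rule neighboring_flip_coords[OF x(2)])
  ultimately show ?thesis using x edge_in by (intro that) (auto simp: M_def)
qed

lemma rtrancl_exits_set:
  assumes "(x, y) \<in> r\<^sup>*" "x \<in> A" "y \<notin> A"
  obtains u v where "(u, v) \<in> r" "u \<in> A" "v \<notin> A"
  using assms by (induction rule: rtrancl_induct) blast+

theorem theorem15:
  fixes out :: "bool ^ 'n \<Rightarrow> bool ^ 'n" and i :: 'n and P :: "(bool ^ 'n) set set"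
  assumes "unique_sink_orientation out"
    and "P \<in> phases out i"
  shows "Digraph_Component.connected (with_proj (neighborhood_graph i) \<restriction> P)"
proof -
  let ?G = "with_proj (neighborhood_graph i) \<restriction> P"
  obtain e0 where P: "P = in_phase out i `` {e0}"
    using assms(2) unfolding phases_def by (rule quotientE)
  have P_edges: "P \<subseteq> i_edges i" unfolding P in_phase_def by auto
  have P_ne: "P \<noteq> {}" using assms(2) equiv_in_phase unfolding phases_def
    by (metis in_quotient_imp_non_empty)
  have P_path: "(e, e') \<in> (direct_phase out i)\<^sup>*" if "e \<in> P" "e' \<in> P" for e e'
  proof -
    have "(e, e') \<in> in_phase out i"
      using that assms(2) equiv_in_phase in_quotient_imp_in_rel unfolding phases_def by fastforce
    then show ?thesis by (simp add: in_phase_def)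
  qed
  have P_closed: "e' \<in> P" if "e \<in> P" "(e, e') \<in> direct_phase out i" for e e'
  proof -
    have "(e, e') \<in> in_phase out i"
      using that unfolding in_phase_def direct_phase_def by auto
    then show ?thesis
      using that(1) assms(2) equiv_in_phase unfolding phases_def by (metis in_quotient_imp_closed)
  qed
  have arcs: "(a, b) \<in> arcs_ends ?G" if "a \<in> P" "b \<in> P" "a \<noteq> b" "neighboring a b" for a b
    using that P_edges by (auto simp: arcs_ends_def arc_to_ends_def neighborhood_graph_def)
  interpret N: pair_graph "neighborhood_graph i"
    by (rule pair_graph_neighborhood_graph)
  interpret G: wf_digraph ?G
    by (rule N.wellformed_induce_subgraph)
  \<comment> \<open>\<open>connected\<close> asks for strong connectivity of the symmetric closure,
    to which reachability carries over.\<close>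
  have "strongly_connected ?G"
  proof (rule strongly_connectedI)
    show "verts ?G \<noteq> {}" using P_ne by simp
    fix e e' assume "e \<in> verts ?G" "e' \<in> verts ?G"
    then have e: "e \<in> P" "e' \<in> P" by simp_all
    \<comment> \<open>If this reachable set missed \<open>e'\<close>, some direct-phase step would
      leave it; the edge \<open>b\<close> obtained from that step lies in \<open>P\<close> and next
      to \<open>A\<close>, hence in \<open>A\<close>.\<close>
    define A where "A = {a. e \<rightarrow>\<^sup>*\<^bsub>?G\<^esub> a}"
    have "e \<in> A" using e by (simp add: A_def)
    have "A \<subseteq> P" using G.reachable_in_verts(2) by (auto simp: A_def)
    show "e \<rightarrow>\<^sup>*\<^bsub>?G\<^esub> e'"
    proof (rule ccontr)
      assume "\<not> ?thesis"
      then have "e' \<notin> A" by (simp add: A_def)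
      then obtain u v where "(u, v) \<in> direct_phase out i" "u \<in> A" "v \<notin> A"
        using rtrancl_exits_set P_path[OF e] \<open>e \<in> A\<close> by metis
      then obtain a b c where abc: "a \<in> A" "b \<in> i_edges i - A" "neighboring a b" "c \<in> A"
        "(c, b) \<in> direct_phase out i"
        using ex_neighboring_in_direct_phase[OF assms(1)] \<open>A \<subseteq> P\<close> P_edges by (metis subset_trans)
      have "b \<in> P" using P_closed abc(4,5) \<open>A \<subseteq> P\<close> by blast
      then have "(a, b) \<in> arcs_ends ?G" using arcs abc \<open>A \<subseteq> P\<close> by blast
      then have "b \<in> A"
        using abc(1) G.reachable_adj_trans unfolding A_def by blast
      then show False using abc(2) by simp
    qed
  qed
  then show ?thesis
    unfolding connected_def strongly_connected_def by (simp add: G.reachable_mk_symmetricI)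
qed

end
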